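(* Let $f^\star$ be the optimal value of $\min_{x\in\mathbb{R}^N}f(x)$, let $R_0=\min_{x^\star\in X^*}\|x^0-x^\star\|_L$, and let $\{x^k\}$ be the sequence generated by the ARCD method started at $x^0$ with parameter $\gamma_0>0$. Then, for any $k\ge0$, $$\mathbf{E}_{\xi_{k-1}}[f(x^k)]-f^\star\ \le\ \lambda_k\left(f(x^0)-f^\star+\frac{\gamma_0R_0^2}{2}\right),$$ where $\lambda_0=1$ and $\lambda_k=\prod_{i=0}^{k-1}\left(1-\frac{\alpha_i}{n}\right)$. In particular, if $\gamma_0\ge\mu$, then $$\lambda_k\ \le\ \min\left\{\left(1-\frac{\sqrt\mu}{n}\right)^k,\ \left(\frac{n}{n+k\frac{\sqrt{\gamma_0}}{2}}\right)^2\right\}.$$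
   Context: Block structure: $x\in\mathbb{R}^N$ is partitioned into $n$ blocks $x_i\in\mathbb{R}^{N_i}$, $i=1,\dots,n$. There is an $N\times N$ permutation matrix $U=[U_1\cdots U_n]$, $U_i\in\mathbb{R}^{N\times N_i}$, with $x=\sum_{i=1}^nU_ix_i$ and $x_i=U_i^Tx$. Each $\mathbb{R}^{N_i}$ carries the standard Euclidean norm $\|\cdot\|$. Problem: $\min_{x\in\mathbb{R}^N}f(x)$, where $f:\mathbb{R}^N\to\mathbb{R}$ is convex and differentiable. The optimal value $f^\star$ is finite and the set $X^*$ of optimal solutions is nonempty. With $\nabla_if(x)=U_i^T\nabla f(x)$, the gradient is block-wise Lipschitz with constants $L_i>0$: $\|\nabla_if(x+U_ih_i)-\nabla_if(x)\|\le L_i\|h_i\|$ for all $x\in\mathbb{R}^N$, $h_i\in\mathbb{R}^{N_i}$, $i=1,\dots,n$. Norm: $\|x\|_L=\bigl(\sum_{i=1}^nL_i\|x_i\|^2\bigr)^{1/2}$. $\mu\ge0$ is the convexity parameter of $f$ with respect to $\|\cdot\|_L$, i.e. the largest $\mu\ge0$ such that $f(y)\ge f(x)+\langle\nabla f(x),y-x\rangle+\frac\mu2\|y-x\|_L^2$ for all $x,y\in\mathbb{R}^N$ (the Lipschitz assumption implies $\mu\le1$). ARCD method: given $x^0\in\mathbb{R}^N$, set $v^0=x^0$, choose $\gamma_0>0$ arbitrarily, and repeat for $k=0,1,2,\dots$: 1. Compute $\alpha_k\in(0,n]$ from the equation $\alpha_k^2=\left(1-\frac{\alpha_k}{n}\right)\gamma_k+\frac{\alpha_k}{n}\mu$,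 and set $\gamma_{k+1}=\left(1-\frac{\alpha_k}{n}\right)\gamma_k+\frac{\alpha_k}{n}\mu$. (These are well defined, with $\gamma_k>0$ for all $k$.) 2. Set $y^k=\frac{1}{\frac{\alpha_k}{n}\gamma_k+\gamma_{k+1}}\left(\frac{\alpha_k}{n}\gamma_kv^k+\gamma_{k+1}x^k\right)$. 3. Choose $i_k\in\{1,\dots,n\}$ uniformly at random (independently across iterations) and set $x^{k+1}=y^k-\frac{1}{L_{i_k}}U_{i_k}\nabla_{i_k}f(y^k)$. 4. Set $v^{k+1}=\frac{1}{\gamma_{k+1}}\left(\left(1-\frac{\alpha_k}{n}\right)\gamma_kv^k+\frac{\alpha_k}{n}\mu y^k-\frac{\alpha_k}{L_{i_k}}U_{i_k}\nabla_{i_k}f(y^k)\right)$. Write $\xi_{k-1}=\{i_0,\dots,i_{k-1}\}$; $\mathbf{E}_{\xi_{k-1}}$ is expectation over $\xi_{k-1}$, with $\mathbf{E}_{\xi_{-1}}[f(x^0)]=f(x^0)$. *)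

theory Defs
  imports "HOL-Probability.Probability"
begin

(* The permutation matrix [U_1 ... U_n] is given by its columns: U i j (1 <= i <= n, 1 <= j <= Ns i)
   is the j-th column of the block U_i. A permutation matrix is a square matrix whose columns
   are the standard basis vectors, each occurring exactly once.
   A vector of the i-th block space is a function nat => real of which only
   the entries 1, ..., Ns i are relevant; its Euclidean norm is L2_set _ {1..Ns i}. *)
definition block_permutation ::
  "nat \<Rightarrow> (nat \<Rightarrow> nat) \<Rightarrow> (nat \<Rightarrow> nat \<Rightarrow> real ^ 'N) \<Rightarrow> bool" where
  "block_permutation n Ns U \<longleftrightarrow>
     bij_betw (\<lambda>(i, j). U i j) (SIGMA i:{1..n}. {1..Ns i}) (Basis :: (real ^ 'N) set)"

(* U_i h *)
definition block_embed ::
  "(nat \<Rightarrow> nat) \<Rightarrow> (nat \<Rightarrow> nat \<Rightarrow> real ^ 'N) \<Rightarrow> nat \<Rightarrow> (nat \<Rightarrow> real) \<Rightarrow> real ^ 'N" where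
  "block_embed Ns U i h = (\<Sum>j = 1..Ns i. h j *\<^sub>R U i j)"

(* the transpose of U_i applied to x *)
definition block_proj ::
  "(nat \<Rightarrow> nat \<Rightarrow> real ^ 'N) \<Rightarrow> nat \<Rightarrow> real ^ 'N \<Rightarrow> (nat \<Rightarrow> real)" where
  "block_proj U i x = (\<lambda>j. U i j \<bullet> x)"

lemma block_decomposition:
  fixes x :: "real ^ 'N"
  assumes "block_permutation n Ns U"
  shows "x = (\<Sum>i = 1..n. block_embed Ns U i (block_proj U i x))"
proof -
  have "(\<Sum>i = 1..n. block_embed Ns U i (block_proj U i x)) =
        (\<Sum>(i, j)\<in>(SIGMA i:{1..n}. {1..Ns i}). (U i j \<bullet> x) *\<^sub>R U i j)"
    unfolding block_embed_def block_proj_def by (rule sum.Sigma) auto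
  also have "\<dots> = (\<Sum>b\<in>Basis. (b \<bullet> x) *\<^sub>R b)"
    using sum.reindex_bij_betw[OF assms[unfolded block_permutation_def],
        of "\<lambda>b. (b \<bullet> x) *\<^sub>R b"]
    by (simp add: case_prod_unfold)
  also have "\<dots> = x"
    by (simp only: inner_commute[of _ x] euclidean_representation)
  finally show ?thesis by (rule sym)
qed

definition gradient :: "(real ^ 'N \<Rightarrow> real) \<Rightarrow> real ^ 'N \<Rightarrow> real ^ 'N" where
  "gradient f x = (THE D. GDERIV f x :> D)"

lemma gradient_works:
  fixes f :: "real ^ 'N \<Rightarrow> real"
  assumes "f differentiable (at x)"
  shows "GDERIV f x :> gradient f x"
proof -
  obtain f' where f': "(f has_derivative f') (at x)"
    using assms by (auto simp: differentiable_def)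
  define D where "D = (\<Sum>b\<in>Basis. f' b *\<^sub>R b)"
  have lin: "linear f'"
    using f' by (rule has_derivative_linear)
  have "f' h = h \<bullet> D" for h
  proof -
    have "f' h = f' (\<Sum>b\<in>Basis. (h \<bullet> b) *\<^sub>R b)"
      by (simp only: euclidean_representation)
    also have "\<dots> = h \<bullet> D"
      by (simp only: D_def linear_sum[OF lin] linear_cmul[OF lin] inner_sum_right inner_scaleR_right
          real_scaleR_def mult.commute)
    finally show ?thesis .
  qed
  then have "f' = (\<lambda>h. h \<bullet> D)" by (rule ext)
  then have D: "GDERIV f x :> D"
    using f' by (simp add: gderiv_def)
  moreover have "D' = D" if "GDERIV f x :> D'" for D'
  proof -
    have "(\<lambda>h. h \<bullet> D') = (\<lambda>h. h \<bullet> D)"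
      by (rule has_derivative_unique[OF that[unfolded gderiv_def] D[unfolded gderiv_def]])
    then have "\<forall>h. h \<bullet> D' = h \<bullet> D"
      by (rule fun_cong[THEN allI])
    then show ?thesis
      by (simp only: vector_eq_ldot)
  qed
  ultimately show ?thesis
    unfolding gradient_def by (rule theI)
qed

definition block_gradient ::
  "(nat \<Rightarrow> nat \<Rightarrow> real ^ 'N) \<Rightarrow> (real ^ 'N \<Rightarrow> real) \<Rightarrow> nat \<Rightarrow> real ^ 'N \<Rightarrow> (nat \<Rightarrow> real)" where
  "block_gradient U f i x = block_proj U i (gradient f x)"

definition block_lipschitz_gradient ::
  "nat \<Rightarrow> (nat \<Rightarrow> nat) \<Rightarrow> (nat \<Rightarrow> nat \<Rightarrow> real ^ 'N) \<Rightarrow> (nat \<Rightarrow> real) \<Rightarrow>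
   (real ^ 'N \<Rightarrow> real) \<Rightarrow> bool" where
  "block_lipschitz_gradient n Ns U L f \<longleftrightarrow>
     (\<forall>i\<in>{1..n}. \<forall>x h.
        L2_set (\<lambda>j. block_gradient U f i (x + block_embed Ns U i h) j - block_gradient U f i x j)
          {1..Ns i}
        \<le> L i * L2_set h {1..Ns i})"

definition norm_L ::
  "nat \<Rightarrow> (nat \<Rightarrow> nat) \<Rightarrow> (nat \<Rightarrow> nat \<Rightarrow> real ^ 'N) \<Rightarrow> (nat \<Rightarrow> real) \<Rightarrow> real ^ 'N \<Rightarrow> real" where
  "norm_L n Ns U L x = sqrt (\<Sum>i = 1..n. L i * (L2_set (block_proj U i x) {1..Ns i})\<^sup>2)"

definition convexity_parameter ::
  "nat \<Rightarrow> (nat \<Rightarrow> nat) \<Rightarrow> (nat \<Rightarrow> nat \<Rightarrow> real ^ 'N) \<Rightarrow> (nat \<Rightarrow> real) \<Rightarrow>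
   (real ^ 'N \<Rightarrow> real) \<Rightarrow> real" where
  "convexity_parameter n Ns U L f =
     (GREATEST \<mu>. \<mu> \<ge> 0 \<and>
        (\<forall>x y. f y \<ge> f x + gradient f x \<bullet> (y - x) + \<mu> / 2 * (norm_L n Ns U L (y - x))\<^sup>2))"

definition optimal_value :: "(real ^ 'N \<Rightarrow> real) \<Rightarrow> real" where
  "optimal_value f = (INF x. f x)"

definition optimal_set :: "(real ^ 'N \<Rightarrow> real) \<Rightarrow> (real ^ 'N) set" where
  "optimal_set f = {x. \<forall>y. f x \<le> f y}"

(* LEAST is the minimum here; it is attained because the set of minimizers of a differentiable f is closed. *)
definition initial_distance ::
  "nat \<Rightarrow> (nat \<Rightarrow> nat) \<Rightarrow> (nat \<Rightarrow> nat \<Rightarrow> real ^ 'N) \<Rightarrow> (nat \<Rightarrow> real) \<Rightarrow>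
   (real ^ 'N \<Rightarrow> real) \<Rightarrow> real ^ 'N \<Rightarrow> real" where
  "initial_distance n Ns U L f x0 =
     (LEAST r. r \<in> (\<lambda>xs. norm_L n Ns U L (x0 - xs)) ` optimal_set f)"

definition arcd_params ::
  "nat \<Rightarrow> real \<Rightarrow> real \<Rightarrow> (nat \<Rightarrow> real) \<Rightarrow> (nat \<Rightarrow> real) \<Rightarrow> bool" where
  "arcd_params n \<mu> \<gamma>0 \<alpha> \<gamma> \<longleftrightarrow>
     \<gamma> 0 = \<gamma>0 \<and>
     (\<forall>k. 0 < \<alpha> k \<and> \<alpha> k \<le> real n \<and>
          (\<alpha> k)\<^sup>2 = (1 - \<alpha> k / real n) * \<gamma> k + \<alpha> k / real n * \<mu> \<and>
          \<gamma> (Suc k) = (1 - \<alpha> k / real n) * \<gamma> k + \<alpha> k / real n * \<mu>)"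

definition arcd_y ::
  "nat \<Rightarrow> (nat \<Rightarrow> real) \<Rightarrow> (nat \<Rightarrow> real) \<Rightarrow> nat \<Rightarrow> real ^ 'N \<Rightarrow> real ^ 'N \<Rightarrow> real ^ 'N" where
  "arcd_y n \<alpha> \<gamma> k x v =
     (1 / (\<alpha> k / real n * \<gamma> k + \<gamma> (Suc k))) *\<^sub>R
       ((\<alpha> k / real n * \<gamma> k) *\<^sub>R v + \<gamma> (Suc k) *\<^sub>R x)"

(* The pair (x^k, v^k) for the sequence idx of selected blocks; only idx 0, ..., idx (k - 1) are used. *)
primrec arcd ::
  "nat \<Rightarrow> (nat \<Rightarrow> nat) \<Rightarrow> (nat \<Rightarrow> nat \<Rightarrow> real ^ 'N) \<Rightarrow> (nat \<Rightarrow> real) \<Rightarrow> (real ^ 'N \<Rightarrow> real) \<Rightarrow>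
   real \<Rightarrow> (nat \<Rightarrow> real) \<Rightarrow> (nat \<Rightarrow> real) \<Rightarrow> real ^ 'N \<Rightarrow> (nat \<Rightarrow> nat) \<Rightarrow> nat \<Rightarrow>
   (real ^ 'N) \<times> (real ^ 'N)" where
  "arcd n Ns U L f \<mu> \<alpha> \<gamma> x0 idx 0 = (x0, x0)"
| "arcd n Ns U L f \<mu> \<alpha> \<gamma> x0 idx (Suc k) =
     (let (x, v) = arcd n Ns U L f \<mu> \<alpha> \<gamma> x0 idx k;
          y = arcd_y n \<alpha> \<gamma> k x v;
          i = idx k;
          g = block_embed Ns U i (block_gradient U f i y)
      in (y - (1 / L i) *\<^sub>R g,
          (1 / \<gamma> (Suc k)) *\<^sub>R
            (((1 - \<alpha> k / real n) * \<gamma> k) *\<^sub>R v + (\<alpha> k / real n * \<mu>) *\<^sub>R y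
             - (\<alpha> k / L i) *\<^sub>R g)))"

definition arcd_x ::
  "nat \<Rightarrow> (nat \<Rightarrow> nat) \<Rightarrow> (nat \<Rightarrow> nat \<Rightarrow> real ^ 'N) \<Rightarrow> (nat \<Rightarrow> real) \<Rightarrow> (real ^ 'N \<Rightarrow> real) \<Rightarrow>
   real \<Rightarrow> (nat \<Rightarrow> real) \<Rightarrow> (nat \<Rightarrow> real) \<Rightarrow> real ^ 'N \<Rightarrow> (nat \<Rightarrow> nat) \<Rightarrow> nat \<Rightarrow> real ^ 'N" where
  "arcd_x n Ns U L f \<mu> \<alpha> \<gamma> x0 idx k = fst (arcd n Ns U L f \<mu> \<alpha> \<gamma> x0 idx k)"

definition arcd_lambda :: "nat \<Rightarrow> (nat \<Rightarrow> real) \<Rightarrow> nat \<Rightarrow> real" where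
  "arcd_lambda n \<alpha> k = (\<Prod>i<k. (1 - \<alpha> i / real n))"

definition iid_uniform_blocks :: "nat \<Rightarrow> 'w measure \<Rightarrow> (nat \<Rightarrow> 'w \<Rightarrow> nat) \<Rightarrow> bool" where
  "iid_uniform_blocks n M I \<longleftrightarrow>
     prob_space.indep_vars M (\<lambda>_. count_space UNIV) I UNIV \<and>
     (\<forall>k. distr M (count_space UNIV) (I k) = measure_pmf (pmf_of_set {1..n}))"

end

theory Submission
  imports Defs
begin

text \<open>
  The proof tracks the potential
  \<open>\<Phi>\<^sub>k(x, v) = f x - f x\<^sup>* + \<gamma>\<^sub>k / 2 * (norm_L (v - x\<^sup>*))\<^sup>2\<close>, where \<open>x\<^sup>*\<close> is the minimizer that is
  nearest to \<open>x0\<close> in the weighted norm. At the start it equals \<open>f x0 - f x\<^sup>* + \<gamma>0 R0\<^sup>2 / 2\<close>, and it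
  always dominates \<open>f x - f x\<^sup>*\<close>, so it is enough that one step of the method multiplies its mean
  over the chosen block by at most \<open>1 - \<alpha>\<^sub>k / n\<close> (lemma \<open>mean_potential_decrease\<close>).

  Two facts make this work. The gradient step in block \<open>i\<close> lowers \<open>f\<close> by at least
  \<open>1 / (2 L\<^sub>i)\<close> times the squared norm of the block gradient (by \<open>block_descent\<close>); because
  \<open>\<gamma>\<^sub>k\<^sub>+\<^sub>1 = \<alpha>\<^sub>k\<^sup>2\<close>, this is exactly the second-order increase that the movement of \<open>v\<close> causes in the
  distance term. What remains is linear in the block gradients, so its mean over \<open>i\<close> involves only
  the full gradient at \<open>y\<close>. Strong convexity towards \<open>x\<^sup>*\<close> and convexity towards \<open>x\<close> then bound
  it, and \<open>y\<close> is chosen so that the inner products with the gradient cancel.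

  Lemma \<open>expectation_iid_uniform_blocks\<close> turns the expectation into a plain average over all
  sequences of \<open>k\<close> blocks, where the one-step estimate can be iterated without conditional
  expectations. The product \<open>\<lambda>\<^sub>k\<close> is estimated from the recursion for \<open>\<gamma>\<close> alone: \<open>\<gamma>\<^sub>k \<ge> \<mu>\<close> gives
  the geometric rate, \<open>\<gamma>\<^sub>k \<ge> \<gamma>0 \<lambda>\<^sub>k\<close> the quadratic one.
\<close>

section \<open>Blocks and the weighted norm\<close>

locale weighted_blocks =
  fixes n :: nat and Ns :: "nat \<Rightarrow> nat" and U :: "nat \<Rightarrow> nat \<Rightarrow> real ^ 'N" and L :: "nat \<Rightarrow> real"
  assumes blocks: "block_permutation n Ns U"
    and L_pos: "\<And>i. i \<in> {1..n} \<Longrightarrow> L i > 0"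
begin

lemma U_orthonormal:
  assumes "i \<in> {1..n}" "j \<in> {1..Ns i}" "i' \<in> {1..n}" "j' \<in> {1..Ns i'}"
  shows "U i j \<bullet> U i' j' = (if i = i' \<and> j = j' then 1 else 0)"
proof -
  have inj: "inj_on (\<lambda>(i, j). U i j) (SIGMA i:{1..n}. {1..Ns i})"
    and img: "(\<lambda>(i, j). U i j) ` (SIGMA i:{1..n}. {1..Ns i}) = Basis"
    using blocks unfolding block_permutation_def bij_betw_def by auto
  have "U i j \<in> Basis" "U i' j' \<in> Basis"
    unfolding img[symmetric] using assms by force+
  moreover have "U i j = U i' j' \<longleftrightarrow> i = i' \<and> j = j'"
    using inj_on_eq_iff[OF inj, of "(i, j)" "(i', j')"] assms by auto
  ultimately show ?thesis by (simp add: inner_Basis)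
qed

lemma inner_block_embed: "z \<bullet> block_embed Ns U i h = (\<Sum>j = 1..Ns i. h j * block_proj U i z j)"
  unfolding block_embed_def block_proj_def by (simp add: inner_sum_right inner_commute)

lemma block_proj_embed:
  assumes "i \<in> {1..n}" "j \<in> {1..Ns i}" "i' \<in> {1..n}"
  shows "block_proj U i (block_embed Ns U i' h) j = (if i = i' then h j else 0)"
proof -
  have "block_proj U i (block_embed Ns U i' h) j = (\<Sum>j' = 1..Ns i'. h j' * (U i j \<bullet> U i' j'))"
    unfolding block_proj_def block_embed_def by (simp add: inner_sum_right)
  also have "\<dots> = (\<Sum>j' = 1..Ns i'. if j' = j then (if i = i' then h j else 0) else 0)"
    by (rule sum.cong) (use assms in \<open>auto simp: U_orthonormal\<close>)
  also have "\<dots> = (if i = i' then h j else 0)"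
    using assms by (subst sum.delta) auto
  finally show ?thesis .
qed

lemma inner_block_embed_embed:
  assumes "i \<in> {1..n}" "i' \<in> {1..n}"
  shows "block_embed Ns U i h \<bullet> block_embed Ns U i' h' = (if i = i' then \<Sum>j = 1..Ns i. h j * h' j else 0)"
  using assms by (simp add: inner_block_embed block_proj_embed mult.commute cong: sum.cong_simp)

lemma norm_block_embed:
  assumes "i \<in> {1..n}"
  shows "norm (block_embed Ns U i h) = L2_set h {1..Ns i}"
  using assms by (simp add: norm_eq_sqrt_inner inner_block_embed_embed L2_set_def power2_eq_square)

text \<open>
  The weighted norm is the Euclidean norm after an invertible linear change of coordinates. This
  makes the usual inner product algebra and the closedness of linear images available for it.
\<close>
definition scaling :: "real ^ 'N \<Rightarrow> real ^ 'N" where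
  "scaling x = (\<Sum>i = 1..n. sqrt (L i) *\<^sub>R block_embed Ns U i (block_proj U i x))"

lemma linear_scaling: "linear scaling"
  unfolding scaling_def block_embed_def block_proj_def
  by (intro linearI)
     (simp_all add: inner_add_right algebra_simps sum.distrib scaleR_sum_right)

lemma inner_scaling_scaling:
  "scaling x \<bullet> scaling z = (\<Sum>i = 1..n. L i * (\<Sum>j = 1..Ns i. block_proj U i x j * block_proj U i z j))"
proof -
  have "scaling x \<bullet> scaling z = (\<Sum>i = 1..n. \<Sum>i' = 1..n.
      if i' = i then L i * (\<Sum>j = 1..Ns i. block_proj U i x j * block_proj U i z j) else 0)"
    unfolding scaling_def inner_sum_left inner_sum_right
    by (rule sum.cong[OF refl], rule sum.cong[OF refl])
       (auto simp: inner_block_embed_embed less_imp_le[OF L_pos] mult.assoc[symmetric])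
  then show ?thesis by (simp add: sum.delta)
qed

lemma norm_L_eq_norm_scaling: "norm_L n Ns U L x = norm (scaling x)"
  unfolding norm_L_def norm_eq_sqrt_inner inner_scaling_scaling
  by (simp add: L2_set_def sum_nonneg power2_eq_square)

text \<open>
  On a single block the weighted inner product is the Euclidean one times \<open>L i\<close>. This factor cancels
  the step length \<open>1 / L i\<close>, which is why the linear terms add up to the full gradient.
\<close>
lemma inner_scaling_block_embed:
  assumes "i \<in> {1..n}"
  shows "scaling w \<bullet> scaling (block_embed Ns U i h) = L i * (w \<bullet> block_embed Ns U i h)"
proof -
  have "scaling w \<bullet> scaling (block_embed Ns U i h)
      = (\<Sum>i' = 1..n. if i' = i then L i * (\<Sum>j = 1..Ns i. block_proj U i w j * h j) else 0)"
    unfolding inner_scaling_scaling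
    by (rule sum.cong[OF refl]) (use assms in \<open>auto simp: block_proj_embed cong: sum.cong_simp\<close>)
  then show ?thesis using assms by (simp add: inner_block_embed mult.commute)
qed

lemma scaling_eq_0_iff: "scaling x = 0 \<longleftrightarrow> x = 0"
proof
  assume "scaling x = 0"
  then have "(\<Sum>i = 1..n. L i * (L2_set (block_proj U i x) {1..Ns i})\<^sup>2) = 0"
    using norm_L_eq_norm_scaling[of x] unfolding norm_L_def by simp
  then have "\<forall>i\<in>{1..n}. L i * (L2_set (block_proj U i x) {1..Ns i})\<^sup>2 = 0"
    by (subst (asm) sum_nonneg_eq_0_iff) (auto intro!: mult_nonneg_nonneg simp: less_imp_le[OF L_pos])
  then have "norm (block_embed Ns U i (block_proj U i x)) = 0" if "i \<in> {1..n}" for i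
    using L_pos[OF that] that unfolding norm_block_embed[OF that] by force
  then show "x = 0" by (subst block_decomposition[OF blocks]) simp
qed (simp add: linear_0[OF linear_scaling])

text \<open>
  Blocks may have dimension zero, but not all of them. Hence the Lipschitz condition is not vacuous
  for some block, which is what bounds the convexity parameter from above.
\<close>
lemma exists_block_vector:
  obtains i h where "i \<in> {1..n}" "block_embed Ns U i h \<noteq> 0"
proof (rule ccontr)
  assume "\<not> thesis"
  then have "\<forall>i\<in>{1..n}. \<forall>h. block_embed Ns U i h = 0" using that by blast
  then have "x = 0" for x :: "real ^ 'N" by (subst block_decomposition[OF blocks]) simp
  then have "One = (0 :: real ^ 'N)" by blast
  then show False by simp
qed

lemma n_pos: "n > 0"
  using exists_block_vector by fastforce

end


section \<open>Convexity, smoothness and the minimizers\<close>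

lemma gradient_line_derivative:
  assumes "\<And>x. f differentiable (at x)"
  shows "((\<lambda>t. f (x + t *\<^sub>R d)) has_real_derivative gradient f (x + t *\<^sub>R d) \<bullet> d) (at t)"
proof -
  have 1: "(f has_derivative (\<lambda>h. h \<bullet> gradient f (x + t *\<^sub>R d))) (at (x + t *\<^sub>R d))"
    using gradient_works[OF assms] by (simp add: gderiv_def)
  have "((\<lambda>t. x + t *\<^sub>R d) has_derivative (\<lambda>s. s *\<^sub>R d)) (at t)"
    by (auto intro!: derivative_eq_intros)
  from has_derivative_compose[OF this 1] show ?thesis
    by (simp add: has_field_derivative_def inner_commute mult_commute_abs)
qed

text \<open>
  The restriction of \<open>f\<close> to the line from \<open>x\<close> to \<open>y\<close> is convex in one real variable, where the
  tangent inequality is known.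
\<close>
lemma convex_above_tangent:
  assumes "convex_on UNIV f" "\<And>x. f differentiable (at x)"
  shows "f y \<ge> f x + gradient f x \<bullet> (y - x)"
proof -
  have "convex_on UNIV (\<lambda>t::real. f (x + t *\<^sub>R (y - x)))"
  proof (intro convex_onI)
    fix t a b :: real assume t: "0 < t" "t < 1"
    have *: "x + ((1 - t) *\<^sub>R a + t *\<^sub>R b) *\<^sub>R (y - x)
        = (1 - t) *\<^sub>R (x + a *\<^sub>R (y - x)) + t *\<^sub>R (x + b *\<^sub>R (y - x))"
      by (simp add: algebra_simps)
    show "f (x + ((1 - t) *\<^sub>R a + t *\<^sub>R b) *\<^sub>R (y - x))
        \<le> (1 - t) * f (x + a *\<^sub>R (y - x)) + t * f (x + b *\<^sub>R (y - x))"
      unfolding * using convex_onD[OF assms(1)] t by simp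
  qed simp
  from convex_on_imp_above_tangent[OF this _ _ _ gradient_line_derivative[OF assms(2)], of 0 1]
  show ?thesis by simp
qed

lemma optimal_value_eq:
  assumes "xs \<in> optimal_set f"
  shows "optimal_value f = f xs"
  unfolding optimal_value_def using assms unfolding optimal_set_def
  by (intro cInf_eq_minimum) auto

context weighted_blocks
begin

text \<open>
  Along the segment, the difference between \<open>f\<close> and the quadratic upper model is nonincreasing: its
  derivative is \<open>\<le> 0\<close> by Cauchy--Schwarz and the Lipschitz condition within the block.
\<close>
lemma block_descent:
  assumes diff: "\<And>x. f differentiable (at x)"
    and lip: "block_lipschitz_gradient n Ns U L f" and i: "i \<in> {1..n}"
  shows "f (x + block_embed Ns U i h)
           \<le> f x + gradient f x \<bullet> block_embed Ns U i h + L i / 2 * (norm (block_embed Ns U i h))\<^sup>2"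
proof -
  define e where "e = block_embed Ns U i h"
  let ?\<phi> = "\<lambda>t. f (x + t *\<^sub>R e) - t * (gradient f x \<bullet> e) - L i / 2 * t\<^sup>2 * (norm e)\<^sup>2"
  have "?\<phi> 1 \<le> ?\<phi> 0"
  proof (rule DERIV_nonpos_imp_nonincreasing[where f = ?\<phi>])
    fix t :: real assume t: "0 \<le> t" "t \<le> 1"
    let ?d = "\<lambda>j. block_gradient U f i (x + t *\<^sub>R e) j - block_gradient U f i x j"
    have te: "t *\<^sub>R e = block_embed Ns U i (\<lambda>j. t * h j)"
      unfolding e_def block_embed_def by (simp add: scaleR_sum_right)
    have "(gradient f (x + t *\<^sub>R e) - gradient f x) \<bullet> e = (\<Sum>j = 1..Ns i. h j * ?d j)"
      unfolding e_def inner_block_embed block_gradient_def block_proj_def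
      by (simp add: inner_diff_right)
    also have "\<dots> \<le> (\<Sum>j = 1..Ns i. \<bar>h j\<bar> * \<bar>?d j\<bar>)"
      by (rule sum_mono) (simp flip: abs_mult)
    also have "\<dots> \<le> L2_set h {1..Ns i} * L2_set ?d {1..Ns i}"
      by (rule L2_set_mult_ineq)
    also have "L2_set ?d {1..Ns i} \<le> L i * norm (t *\<^sub>R e)"
      using lip i unfolding te norm_block_embed[OF i] block_lipschitz_gradient_def by blast
    also have "L2_set h {1..Ns i} = norm e"
      unfolding e_def by (rule norm_block_embed[OF i, symmetric])
    also have "norm e * (L i * norm (t *\<^sub>R e)) = L i * t * (norm e)\<^sup>2"
      using t by (simp add: power2_eq_square)
    finally have "gradient f (x + t *\<^sub>R e) \<bullet> e - gradient f x \<bullet> e - L i * t * (norm e)\<^sup>2 \<le> 0"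
      by (simp add: inner_diff_left mult_left_mono)
    moreover have "(?\<phi> has_real_derivative
        gradient f (x + t *\<^sub>R e) \<bullet> e - gradient f x \<bullet> e - L i * t * (norm e)\<^sup>2) (at t)"
      by (auto intro!: derivative_eq_intros gradient_line_derivative[OF diff])
    ultimately show "\<exists>y. (?\<phi> has_real_derivative y) (at t) \<and> y \<le> 0" by blast
  qed simp
  then show ?thesis by (simp add: e_def)
qed

text \<open>
  The convexity parameter is given by a description operator, so these properties require that the
  largest admissible modulus exists. The admissible moduli form a closed set that contains
  \<open>0\<close> by convexity. They are at most \<open>1\<close>, since for a nonzero direction inside one block a larger
  modulus contradicts the quadratic upper bound.
\<close>
lemma convexity_parameter_properties:
  fixes f
  defines "\<mu> \<equiv> convexity_parameter n Ns U L f"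
  assumes conv: "convex_on UNIV f" and diff: "\<And>x. f differentiable (at x)"
    and lip: "block_lipschitz_gradient n Ns U L f"
  shows "\<mu> \<ge> 0"
    and "f y \<ge> f x + gradient f x \<bullet> (y - x) + \<mu> / 2 * (norm_L n Ns U L (y - x))\<^sup>2"
proof -
  define S where "S = {m. 0 \<le> m \<and> (\<forall>x y. f y \<ge> f x + gradient f x \<bullet> (y - x)
      + m / 2 * (norm_L n Ns U L (y - x))\<^sup>2)}"
  obtain i h where i: "i \<in> {1..n}" and h: "block_embed Ns U i h \<noteq> 0"
    by (rule exists_block_vector)
  have bound: "m \<le> 1" if "m \<in> S" for m
  proof -
    define e where "e = block_embed Ns U i h"
    have "f e \<ge> f 0 + gradient f 0 \<bullet> (e - 0) + m / 2 * (norm_L n Ns U L (e - 0))\<^sup>2"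
      using that unfolding S_def by blast
    moreover have "f (0 + e) \<le> f 0 + gradient f 0 \<bullet> e + L i / 2 * (norm e)\<^sup>2"
      unfolding e_def by (rule block_descent[OF diff lip i])
    moreover have "(norm_L n Ns U L e)\<^sup>2 = L i * (norm e)\<^sup>2"
      unfolding norm_L_eq_norm_scaling power2_norm_eq_inner e_def
      by (rule inner_scaling_block_embed[OF i])
    ultimately have "m * (L i * (norm e)\<^sup>2) \<le> 1 * (L i * (norm e)\<^sup>2)" by simp
    moreover have "L i * (norm e)\<^sup>2 > 0" using L_pos[OF i] h by (simp add: e_def)
    ultimately show "m \<le> 1" by (rule mult_right_le_imp_le)
  qed
  have ne: "0 \<in> S"
    unfolding S_def using convex_above_tangent[OF conv diff] by simp
  have "closed S"
    unfolding S_def by (intro closed_Collect_conj closed_Collect_all closed_Collect_le continuous_intros) simp_all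
  then have "Sup S \<in> S"
    using ne bound by (intro closed_contains_Sup) (auto intro: bdd_aboveI[of _ 1])
  moreover have "m \<le> Sup S" if "m \<in> S" for m
    using that bound by (intro cSup_upper) (auto intro: bdd_aboveI[of _ 1])
  moreover have "\<mu> = (GREATEST m. m \<in> S)"
    unfolding \<mu>_def convexity_parameter_def S_def by simp
  ultimately have "\<mu> \<in> S"
    by (metis (no_types, lifting) Greatest_equality)
  then show "\<mu> \<ge> 0"
    and "f y \<ge> f x + gradient f x \<bullet> (y - x) + \<mu> / 2 * (norm_L n Ns U L (y - x))\<^sup>2"
    unfolding S_def by auto
qed

text \<open>
  The change of coordinates \<open>scaling\<close> maps the closed set of minimizers to a closed set, and in
  Euclidean space a nonempty closed set has a point nearest to the image of \<open>x0\<close>.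
\<close>
lemma initial_distance_attained:
  assumes diff: "\<And>x. f differentiable (at x)" and ne: "optimal_set f \<noteq> {}"
  obtains xs where "xs \<in> optimal_set f" "initial_distance n Ns U L f x0 = norm_L n Ns U L (x0 - xs)"
proof -
  have "continuous_on UNIV f"
    using diff by (intro differentiable_imp_continuous_on) (simp add: differentiable_on_def)
  then have "closed (optimal_set f)"
    unfolding optimal_set_def by (intro closed_Collect_all closed_Collect_le continuous_intros) auto
  moreover have "inj scaling"
    using scaling_eq_0_iff linear_injective_0[OF linear_scaling] by blast
  ultimately have cl: "closed (scaling ` optimal_set f)"
    by (rule closed_injective_linear_image[OF _ linear_scaling])
  obtain w where "w \<in> scaling ` optimal_set f"
    and w: "\<And>z. z \<in> scaling ` optimal_set f \<Longrightarrow> dist (scaling x0) w \<le> dist (scaling x0) z"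
    using distance_attains_inf[OF cl] ne by (metis image_is_empty)
  then obtain xs where xs: "xs \<in> optimal_set f" "w = scaling xs" by blast
  have d: "dist (scaling x0) (scaling z) = norm_L n Ns U L (x0 - z)" for z
    by (simp add: norm_L_eq_norm_scaling dist_norm linear_diff[OF linear_scaling])
  have "initial_distance n Ns U L f x0 = norm_L n Ns U L (x0 - xs)"
    unfolding initial_distance_def
  proof (rule Least_equality)
    fix r assume "r \<in> (\<lambda>xs. norm_L n Ns U L (x0 - xs)) ` optimal_set f"
    then obtain z where "z \<in> optimal_set f" "r = norm_L n Ns U L (x0 - z)" by blast
    then show "norm_L n Ns U L (x0 - xs) \<le> r"
      using w[OF imageI] xs(2) d by metis
  qed (use xs in blast)
  with xs show thesis using that by blast
qed

end


section \<open>The potential decreases on average in one step\<close>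

text \<open>
  Convexity of the squared norm, in a form that has no division: multiplied by \<open>r\<close>, the
  two sides differ by exactly \<open>p * q * (norm (a - b))\<^sup>2\<close>.
\<close>
lemma norm_convex_combination_squared_le:
  fixes a b :: "'a::real_inner"
  assumes "p \<ge> 0" "q \<ge> 0" "p + q = r" "r > 0" "r *\<^sub>R c = p *\<^sub>R a + q *\<^sub>R b"
  shows "r * (norm c)\<^sup>2 \<le> p * (norm a)\<^sup>2 + q * (norm b)\<^sup>2"
proof -
  have "r * (r * (norm c)\<^sup>2) = (norm (r *\<^sub>R c))\<^sup>2"
    by (simp add: power_mult_distrib power2_eq_square)
  also have "\<dots> = r * (p * (norm a)\<^sup>2 + q * (norm b)\<^sup>2) - p * q * (norm (a - b))\<^sup>2"
    unfolding assms(5) unfolding assms(3)[symmetric] power2_norm_eq_inner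
    by (simp add: inner_add_left inner_add_right inner_diff_left inner_diff_right
        inner_commute algebra_simps)
  also have "\<dots> \<le> r * (p * (norm a)\<^sup>2 + q * (norm b)\<^sup>2)"
    using assms(1,2) by simp
  finally show ?thesis using assms(4) by simp
qed

context weighted_blocks
begin

text \<open>
  One step from \<open>(x, v)\<close>, averaged over the block \<open>i\<close>. The point \<open>w\<close> in the proof is the part of the
  new \<open>v\<close> that does not depend on \<open>i\<close>; thus \<open>\<gamma>' w\<close> is the combination of \<open>v\<close> and \<open>y\<close> with weights
  \<open>\<beta> \<gamma>\<close> and \<open>(a / n) \<mu>\<close>, which sum to \<open>\<gamma>'\<close>.
\<close>
lemma mean_potential_decrease:
  fixes f :: "real ^ 'N \<Rightarrow> real" and x v y xs :: "real ^ 'N"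
    and a \<gamma> \<gamma>' \<mu> :: real
  defines "g \<equiv> \<lambda>i. block_embed Ns U i (block_gradient U f i y)"
  assumes conv: "convex_on UNIV f" and diff: "\<And>x. f differentiable (at x)"
    and lip: "block_lipschitz_gradient n Ns U L f"
    and mu: "\<mu> \<ge> 0"
    and strong: "\<And>x y. f y \<ge> f x + gradient f x \<bullet> (y - x) + \<mu> / 2 * (norm_L n Ns U L (y - x))\<^sup>2"
    and a: "0 < a" "a \<le> real n"
    and \<gamma>: "\<gamma> > 0" "\<gamma>' = (1 - a / n) * \<gamma> + a / n * \<mu>" "\<gamma>' = a\<^sup>2"
    and y: "y = (1 / (a / n * \<gamma> + \<gamma>')) *\<^sub>R ((a / n * \<gamma>) *\<^sub>R v + \<gamma>' *\<^sub>R x)"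
  shows "(\<Sum>i = 1..n. f (y - (1 / L i) *\<^sub>R g i) - f xs
            + \<gamma>' / 2 * (norm_L n Ns U L ((1 / \<gamma>') *\<^sub>R
                (((1 - a / n) * \<gamma>) *\<^sub>R v + (a / n * \<mu>) *\<^sub>R y - (a / L i) *\<^sub>R g i) - xs))\<^sup>2) / n
         \<le> (1 - a / n) * (f x - f xs + \<gamma> / 2 * (norm_L n Ns U L (v - xs))\<^sup>2)"
proof -
  define \<beta> where "\<beta> = 1 - a / n"
  define G where "G = gradient f y"
  define w where "w = (1 / \<gamma>') *\<^sub>R ((\<beta> * \<gamma>) *\<^sub>R v + (a / n * \<mu>) *\<^sub>R y)"
  have \<beta>: "\<beta> \<ge> 0" using a n_pos by (simp add: \<beta>_def)
  have \<gamma>': "\<gamma>' > 0" using \<gamma>(3) a by simp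
  have g_sum: "(\<Sum>i = 1..n. g i) = G"
    unfolding g_def G_def block_gradient_def by (rule block_decomposition[OF blocks, symmetric])
  have inner_G: "G \<bullet> g i = g i \<bullet> g i" if "i \<in> {1..n}" for i
    using that unfolding g_def
    by (simp add: inner_block_embed_embed) (simp add: inner_block_embed G_def block_gradient_def)
  \<comment> \<open>Descent in \<open>f\<close> and the second-order change of the distance cancel, both being
      \<open>(g i \<bullet> g i) / (2 * L i)\<close>.\<close>
  have term_le: "f (y - (1 / L i) *\<^sub>R g i) - f xs
            + \<gamma>' / 2 * (norm_L n Ns U L ((1 / \<gamma>') *\<^sub>R
                (((1 - a / n) * \<gamma>) *\<^sub>R v + (a / n * \<mu>) *\<^sub>R y - (a / L i) *\<^sub>R g i) - xs))\<^sup>2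
         \<le> f y - f xs + \<gamma>' / 2 * (norm_L n Ns U L (w - xs))\<^sup>2 - a * (g i \<bullet> (w - xs))"
    if i: "i \<in> {1..n}" for i
  proof -
    have Li: "L i > 0" by (rule L_pos[OF i])
    have e: "- (1 / L i) *\<^sub>R g i = block_embed Ns U i (\<lambda>j. - (1 / L i) * block_gradient U f i y j)"
      unfolding g_def block_embed_def by (simp add: scaleR_sum_right sum_negf)
    have "f (y + (- (1 / L i)) *\<^sub>R g i)
        \<le> f y + G \<bullet> ((- (1 / L i)) *\<^sub>R g i) + L i / 2 * (norm ((- (1 / L i)) *\<^sub>R g i))\<^sup>2"
      unfolding e G_def by (rule block_descent[OF diff lip i])
    also have "\<dots> = f y - 1 / (2 * L i) * (g i \<bullet> g i)"
      using Li by (simp add: inner_G[OF i] power_mult_distrib dot_square_norm)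
        (simp add: field_simps power2_eq_square)
    finally have desc: "f (y - (1 / L i) *\<^sub>R g i) \<le> f y - 1 / (2 * L i) * (g i \<bullet> g i)" by simp
    define c where "c = a / (\<gamma>' * L i)"
    define d where "d = (1 / \<gamma>') *\<^sub>R (((1 - a / n) * \<gamma>) *\<^sub>R v + (a / n * \<mu>) *\<^sub>R y - (a / L i) *\<^sub>R g i) - xs"
    have "d = (w - xs) - c *\<^sub>R g i"
      unfolding w_def \<beta>_def c_def d_def by (simp add: scaleR_diff_right)
    then have "(norm_L n Ns U L d)\<^sup>2
        = (norm (scaling (w - xs) - c *\<^sub>R scaling (g i)))\<^sup>2"
      by (simp only: norm_L_eq_norm_scaling linear_diff[OF linear_scaling] linear_scale[OF linear_scaling])
    also have "\<dots> = (norm (scaling (w - xs)))\<^sup>2 - 2 * c * (scaling (w - xs) \<bullet> scaling (g i))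
        + c\<^sup>2 * (scaling (g i) \<bullet> scaling (g i))"
      unfolding power2_norm_eq_inner
      by (simp add: inner_diff_left inner_diff_right inner_commute power2_eq_square algebra_simps)
    also have "\<dots> = (norm_L n Ns U L (w - xs))\<^sup>2 - 2 * c * L i * (g i \<bullet> (w - xs))
        + c\<^sup>2 * L i * (g i \<bullet> g i)"
      unfolding g_def by (simp add: inner_scaling_block_embed[OF i] norm_L_eq_norm_scaling inner_commute)
    finally have d_norm: "(norm_L n Ns U L d)\<^sup>2
        = (norm_L n Ns U L (w - xs))\<^sup>2 - 2 * c * L i * (g i \<bullet> (w - xs)) + c\<^sup>2 * L i * (g i \<bullet> g i)" .
    have quad: "\<gamma>' / 2 * (norm_L n Ns U L d)\<^sup>2
        = \<gamma>' / 2 * (norm_L n Ns U L (w - xs))\<^sup>2 - (\<gamma>' * c * L i) * (g i \<bullet> (w - xs))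
          + (\<gamma>' / 2 * c\<^sup>2 * L i) * (g i \<bullet> g i)"
      unfolding d_norm by (simp add: algebra_simps)
    have lin_coeff: "\<gamma>' * c * L i = a" using \<gamma>' Li by (simp add: c_def)
    \<comment> \<open>Here \<open>\<gamma>' = a\<^sup>2\<close> enters.\<close>
    have quad_coeff: "\<gamma>' / 2 * c\<^sup>2 * L i = 1 / (2 * L i)"
      using a Li unfolding c_def \<gamma>(3) by (simp add: field_simps power2_eq_square)
    show ?thesis
      using desc quad unfolding lin_coeff quad_coeff d_def by linarith
  qed
  have "(\<Sum>i = 1..n. f (y - (1 / L i) *\<^sub>R g i) - f xs
            + \<gamma>' / 2 * (norm_L n Ns U L ((1 / \<gamma>') *\<^sub>R
                (((1 - a / n) * \<gamma>) *\<^sub>R v + (a / n * \<mu>) *\<^sub>R y - (a / L i) *\<^sub>R g i) - xs))\<^sup>2) / n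
      \<le> (\<Sum>i = 1..n. f y - f xs + \<gamma>' / 2 * (norm_L n Ns U L (w - xs))\<^sup>2 - a * (g i \<bullet> (w - xs))) / n"
    by (intro divide_right_mono sum_mono term_le) auto
  also have "\<dots> = f y - f xs + \<gamma>' / 2 * (norm_L n Ns U L (w - xs))\<^sup>2 - a / n * (G \<bullet> (w - xs))"
    unfolding g_sum[symmetric] sum_subtractf inner_sum_left
    using n_pos by (simp add: diff_divide_distrib sum_distrib_left[symmetric])
  also have "\<dots> \<le> \<beta> * (f x - f xs + \<gamma> / 2 * (norm_L n Ns U L (v - xs))\<^sup>2)"
  proof -
    have "\<gamma>' *\<^sub>R (w - xs) = (\<beta> * \<gamma>) *\<^sub>R (v - xs) + (a / n * \<mu>) *\<^sub>R (y - xs)"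
      unfolding w_def using \<gamma>' by (simp add: scaleR_diff_right) (simp add: \<gamma>(2) \<beta>_def algebra_simps)
    then have "\<gamma>' *\<^sub>R scaling (w - xs)
        = (\<beta> * \<gamma>) *\<^sub>R scaling (v - xs) + (a / n * \<mu>) *\<^sub>R scaling (y - xs)"
      by (simp only: linear_scale[OF linear_scaling, symmetric] linear_add[OF linear_scaling, symmetric])
    then have quad: "\<gamma>' * (norm_L n Ns U L (w - xs))\<^sup>2
        \<le> \<beta> * \<gamma> * (norm_L n Ns U L (v - xs))\<^sup>2 + a / n * \<mu> * (norm_L n Ns U L (y - xs))\<^sup>2"
      unfolding norm_L_eq_norm_scaling using \<beta> a mu \<gamma> \<gamma>'
      by (intro norm_convex_combination_squared_le) (auto simp: \<beta>_def)
    have "norm_L n Ns U L (xs - y) = norm_L n Ns U L (y - xs)"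
      by (simp add: norm_L_eq_norm_scaling linear_diff[OF linear_scaling] norm_minus_commute)
    with strong[of y xs] have "f y + G \<bullet> (xs - y) + \<mu> / 2 * (norm_L n Ns U L (y - xs))\<^sup>2 \<le> f xs"
      by (simp add: G_def)
    then have s1: "a / n * (f y + G \<bullet> (xs - y) + \<mu> / 2 * (norm_L n Ns U L (y - xs))\<^sup>2) \<le> a / n * f xs"
      using a by (intro mult_left_mono) auto
    have s2: "\<beta> * (f y + G \<bullet> (x - y)) \<le> \<beta> * f x"
      unfolding G_def by (intro mult_left_mono convex_above_tangent[OF conv diff] \<beta>)
    \<comment> \<open>The weights that define \<open>y\<close> are those for which this identity holds; the two tangent
        inequalities, weighted by \<open>\<beta>\<close> and \<open>a / n\<close>, then leave no gradient term.\<close>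
    have "\<beta> *\<^sub>R (x - y) + (a / n) *\<^sub>R (w - y) = 0"
    proof -
      have nz: "a / n * \<gamma> + \<gamma>' \<noteq> 0" using a \<gamma> \<gamma>' n_pos by (simp add: add_pos_pos less_imp_neq[symmetric])
      have "(a / n * \<gamma> + \<gamma>') *\<^sub>R y = (a / n * \<gamma>) *\<^sub>R v + \<gamma>' *\<^sub>R x"
        by (subst y) (simp only: scaleR_scaleR times_divide_eq_right mult_1_right divide_self[OF nz] scaleR_one)
      then have 1: "\<gamma>' *\<^sub>R (x - y) = - ((a / n * \<gamma>) *\<^sub>R (v - y))"
        by (simp add: algebra_simps)
      have 2: "\<gamma>' *\<^sub>R (w - y) = (\<beta> * \<gamma>) *\<^sub>R (v - y)"
        unfolding w_def using \<gamma>' by (simp add: scaleR_diff_right) (simp add: \<gamma>(2) \<beta>_def algebra_simps)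
      have "\<gamma>' *\<^sub>R (\<beta> *\<^sub>R (x - y) + (a / n) *\<^sub>R (w - y))
          = \<beta> *\<^sub>R (\<gamma>' *\<^sub>R (x - y)) + (a / n) *\<^sub>R (\<gamma>' *\<^sub>R (w - y))"
        by (simp add: scaleR_add_right mult.commute)
      also have "\<dots> = 0" unfolding 1 2 by (simp add: mult_ac)
      finally show ?thesis using \<gamma>' by simp
    qed
    then have "G \<bullet> (\<beta> *\<^sub>R (x - y) + (a / n) *\<^sub>R (w - y)) = 0" by simp
    then have s3: "\<beta> * (G \<bullet> (x - y)) + a / n * (G \<bullet> (w - y)) = 0"
      by (simp only: inner_add_right inner_scaleR_right)
    have s4: "a / n * (G \<bullet> (w - xs)) = a / n * (G \<bullet> (w - y)) - a / n * (G \<bullet> (xs - y))"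
      by (simp add: inner_diff_right algebra_simps)
    have s5: "a / n * f y = (1 - \<beta>) * f y" "a / n * f xs = (1 - \<beta>) * f xs" by (simp_all add: \<beta>_def)
    from quad s1 s2 s3 s4 s5 show ?thesis by (simp add: algebra_simps)
  qed
  finally show ?thesis unfolding \<beta>_def .
qed

end

section \<open>Expectation\<close>

lemma sum_PiE_Suc:
  fixes h :: "(nat \<Rightarrow> 'a) \<Rightarrow> real"
  shows "(\<Sum>s\<in>PiE {..<Suc k} (\<lambda>_. S). h s) = (\<Sum>s\<in>PiE {..<k} (\<lambda>_. S). \<Sum>i\<in>S. h (s(k := i)))"
proof -
  have "(\<Sum>s\<in>PiE {..<Suc k} (\<lambda>_. S). h s) = (\<Sum>(i, s)\<in>S \<times> PiE {..<k} (\<lambda>_. S). h (s(k := i)))"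
    unfolding lessThan_Suc PiE_insert_eq
    by (subst sum.reindex[OF inj_combinator]) (auto simp: case_prod_unfold comp_def)
  also have "\<dots> = (\<Sum>i\<in>S. \<Sum>s\<in>PiE {..<k} (\<lambda>_. S). h (s(k := i)))"
    by (rule sum.cartesian_product[symmetric])
  also have "\<dots> = (\<Sum>s\<in>PiE {..<k} (\<lambda>_. S). \<Sum>i\<in>S. h (s(k := i)))"
    by (rule sum.swap)
  finally show ?thesis .
qed

text \<open>
  The function \<open>h\<close> is arbitrary; measurability holds because only countably many values of the first
  \<open>k\<close> coordinates occur, so they can be fixed one coordinate at a time.
\<close>
lemma borel_measurable_finitely_many_coordinates:
  fixes h :: "(nat \<Rightarrow> nat) \<Rightarrow> real"
  assumes I: "\<And>k. I k \<in> measurable M (count_space UNIV)"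
    and dep: "\<And>s t. (\<And>j. j < k \<Longrightarrow> s j = t j) \<Longrightarrow> h s = h t"
  shows "(\<lambda>\<omega>. h (\<lambda>j. I j \<omega>)) \<in> borel_measurable M"
  using dep
proof (induction k arbitrary: h)
  case 0
  then have "(\<lambda>\<omega>. h (\<lambda>j. I j \<omega>)) = (\<lambda>_. h (\<lambda>_. 0))" by auto
  then show ?case by simp
next
  case (Suc k)
  have "(\<lambda>\<omega>. h ((\<lambda>j. I j \<omega>)(k := i))) \<in> borel_measurable M" for i
    by (rule Suc.IH) (auto intro!: Suc.prems simp: less_Suc_eq)
  then have "(\<lambda>\<omega>. h ((\<lambda>j. I j \<omega>)(k := I k \<omega>))) \<in> borel_measurable M"
    by (rule measurable_compose_countable[OF _ I])
  moreover have "(\<lambda>j. I j \<omega>)(k := I k \<omega>) = (\<lambda>j. I j \<omega>)" for \<omega>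
    by (rule ext) simp
  ultimately show ?case by (simp only:)
qed

text \<open>
  Almost surely the first \<open>k\<close> choices form one of the \<open>n ^ k\<close> sequences of blocks, and by independence
  each of these has probability \<open>1 / n ^ k\<close>. Sequences are represented as functions with the default
  value \<open>undefined\<close> from index \<open>k\<close> on; by \<open>dep\<close>, \<open>h\<close> has the same value on them as on the full path.
\<close>
lemma expectation_iid_uniform_blocks:
  fixes h :: "(nat \<Rightarrow> nat) \<Rightarrow> real"
  assumes "prob_space M" and iid: "iid_uniform_blocks n M I" and n: "n > 0"
    and dep: "\<And>s t. (\<And>j. j < k \<Longrightarrow> s j = t j) \<Longrightarrow> h s = h t"
  shows "prob_space.expectation M (\<lambda>\<omega>. h (\<lambda>j. I j \<omega>))
           = (\<Sum>s\<in>PiE {..<k} (\<lambda>_. {1..n}). h s) / real n ^ k"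
proof -
  interpret prob_space M by fact
  have indep: "indep_vars (\<lambda>_. count_space UNIV) I UNIV"
    and distr: "\<And>k. distr M (count_space UNIV) (I k) = measure_pmf (pmf_of_set {1..n})"
    using iid unfolding iid_uniform_blocks_def by auto
  have meas [measurable]: "I k \<in> measurable M (count_space UNIV)" for k
    using indep unfolding indep_vars_def by auto
  have AE1: "AE \<omega> in M. I k \<omega> \<in> {1..n}" for k
  proof -
    have "AE i in distr M (count_space UNIV) (I k). i \<in> {1..n}"
      unfolding distr using n by (auto simp: AE_measure_pmf_iff set_pmf_of_set)
    then show ?thesis by (subst (asm) AE_distr_iff) auto
  qed
  have AE: "AE \<omega> in M. \<forall>k. I k \<omega> \<in> {1..n}"
    using AE1 by (subst AE_all_countable) auto
  define A where "A s = {\<omega> \<in> space M. \<forall>j<k. I j \<omega> = s j}" for s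
  have A_meas [measurable]: "A s \<in> sets M" for s unfolding A_def by measurable
  have prob_A: "prob (A s) = 1 / real n ^ k" if s: "s \<in> PiE {..<k} (\<lambda>_. {1..n})" for s
  proof (cases "k = 0")
    case True
    then show ?thesis by (simp add: A_def prob_space)
  next
    case False
    have "prob (I j -` {s j} \<inter> space M) = 1 / real n" if "j < k" for j
    proof -
      have "prob (I j -` {s j} \<inter> space M) = measure (distr M (count_space UNIV) (I j)) {s j}"
        by (subst measure_distr) auto
      also have "\<dots> = 1 / real n"
        unfolding distr using n PiE_mem[OF s, of j] that by (simp add: measure_pmf_single)
      finally show ?thesis .
    qed
    moreover have "A s = (\<Inter>j\<in>{..<k}. I j -` {s j} \<inter> space M)"
      using False unfolding A_def by auto
    ultimately show ?thesis
      using indep_varsD[OF indep, of "{..<k}" "\<lambda>j. {s j}"] False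
      by (simp add: power_one_over lessThan_empty_iff)
  qed
  have "expectation (\<lambda>\<omega>. h (\<lambda>j. I j \<omega>))
      = expectation (\<lambda>\<omega>. \<Sum>s\<in>PiE {..<k} (\<lambda>_. {1..n}). h s * indicator (A s) \<omega>)"
  proof (rule integral_cong_AE)
    show "(\<lambda>\<omega>. h (\<lambda>j. I j \<omega>)) \<in> borel_measurable M"
      by (rule borel_measurable_finitely_many_coordinates[OF meas dep])
    show "AE \<omega> in M. h (\<lambda>j. I j \<omega>) = (\<Sum>s\<in>PiE {..<k} (\<lambda>_. {1..n}). h s * indicator (A s) \<omega>)"
      using AE AE_space
    proof eventually_elim
      case (elim \<omega>)
      let ?r = "restrict (\<lambda>j. I j \<omega>) {..<k}"
      have "h s * indicator (A s) \<omega> = (if s = ?r then h ?r else 0)"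
        if "s \<in> PiE {..<k} (\<lambda>_. {1..n})" for s
      proof -
        have r: "?r \<in> PiE {..<k} (\<lambda>_. {1..n})" using elim(1) by auto
        have "\<omega> \<in> A s \<longleftrightarrow> (\<forall>j<k. I j \<omega> = s j)"
          using elim(2) by (simp add: A_def)
        also have "\<dots> \<longleftrightarrow> s = ?r"
        proof
          assume "\<forall>j<k. I j \<omega> = s j"
          then show "s = ?r" by (intro PiE_ext[OF that r]) simp
        qed simp
        finally have "\<omega> \<in> A s \<longleftrightarrow> s = ?r" .
        then show ?thesis by auto
      qed
      then have "(\<Sum>s\<in>PiE {..<k} (\<lambda>_. {1..n}). h s * indicator (A s) \<omega>) = h ?r"
        using elim(1) by (simp add: finite_PiE cong: sum.cong_simp)
      also have "\<dots> = h (\<lambda>j. I j \<omega>)" by (rule dep) simp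
      finally show ?case by (rule sym)
    qed
  qed measurable
  also have "\<dots> = (\<Sum>s\<in>PiE {..<k} (\<lambda>_. {1..n}). h s * prob (A s))"
  proof -
    have "integrable M (\<lambda>\<omega>. h s * indicator (A s) \<omega>)" for s
      by (intro integrable_mult_right integrable_real_indicator A_meas) (simp add: emeasure_eq_measure)
    moreover have "expectation (\<lambda>\<omega>. h s * indicator (A s) \<omega>) = h s * prob (A s)" for s
      by (simp add: Int_absorb2 sets.sets_into_space[OF A_meas])
    ultimately show ?thesis by (simp only: Bochner_Integration.integral_sum)
  qed
  also have "\<dots> = (\<Sum>s\<in>PiE {..<k} (\<lambda>_. {1..n}). h s) / real n ^ k"
    by (simp add: prob_A sum_divide_distrib)
  finally show ?thesis .
qed

lemma arcd_cong:
  "(\<And>j. j < k \<Longrightarrow> s j = t j) \<Longrightarrow> arcd n Ns U L f \<mu> \<alpha> \<gamma> x0 s k = arcd n Ns U L f \<mu> \<alpha> \<gamma> x0 t k"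
  by (induction k) auto

context weighted_blocks
begin

text \<open>
  Splitting off the last block of a sequence, the average for \<open>k + 1\<close> is an average of one-step
  averages, to each of which \<open>mean_potential_decrease\<close> applies.
\<close>
lemma mean_potential_le:
  fixes f :: "real ^ 'N \<Rightarrow> real" and x0 xs :: "real ^ 'N"
  assumes conv: "convex_on UNIV f" and diff: "\<And>x. f differentiable (at x)"
    and lip: "block_lipschitz_gradient n Ns U L f"
    and mu: "\<mu> \<ge> 0"
    and strong: "\<And>x y. f y \<ge> f x + gradient f x \<bullet> (y - x) + \<mu> / 2 * (norm_L n Ns U L (y - x))\<^sup>2"
    and params: "arcd_params n \<mu> \<gamma>0 \<alpha> \<gamma>" and pos: "\<And>k. \<gamma> k > 0"
  defines "\<Phi> \<equiv> \<lambda>k (x, v). f x - f xs + \<gamma> k / 2 * (norm_L n Ns U L (v - xs))\<^sup>2"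
  shows "(\<Sum>s\<in>PiE {..<k} (\<lambda>_. {1..n}). \<Phi> k (arcd n Ns U L f \<mu> \<alpha> \<gamma> x0 s k)) / real n ^ k
           \<le> arcd_lambda n \<alpha> k * \<Phi> 0 (x0, x0)"
proof (induction k)
  case 0
  show ?case by (simp add: arcd_lambda_def)
next
  case (Suc k)
  let ?P = "PiE {..<k} (\<lambda>_. {1..n})"
  let ?z = "\<lambda>s k. arcd n Ns U L f \<mu> \<alpha> \<gamma> x0 s k"
  have step: "(\<Sum>i = 1..n. \<Phi> (Suc k) (?z (s(k := i)) (Suc k))) / real n
      \<le> (1 - \<alpha> k / n) * \<Phi> k (?z s k)" for s
  proof -
    obtain x v where xv: "?z s k = (x, v)" by fastforce
    have z: "?z (s(k := i)) k = (x, v)" for i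
      unfolding xv[symmetric] by (rule arcd_cong) simp
    show ?thesis
      using mean_potential_decrease[OF conv diff lip mu strong, where a = "\<alpha> k" and \<gamma> = "\<gamma> k"
          and \<gamma>' = "\<gamma> (Suc k)" and y = "arcd_y n \<alpha> \<gamma> k x v" and v = v and x = x and xs = xs] params pos[of k]
      by (simp add: z xv \<Phi>_def Let_def arcd_params_def arcd_y_def)
  qed
  have le1: "1 - \<alpha> k / n \<ge> 0"
    using params n_pos by (simp add: arcd_params_def)
  have "(\<Sum>s\<in>PiE {..<Suc k} (\<lambda>_. {1..n}). \<Phi> (Suc k) (?z s (Suc k))) / real n ^ Suc k
      = (\<Sum>s\<in>?P. (\<Sum>i = 1..n. \<Phi> (Suc k) (?z (s(k := i)) (Suc k))) / real n) / real n ^ k"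
    unfolding sum_PiE_Suc by (simp add: sum_divide_distrib)
  also have "\<dots> \<le> (\<Sum>s\<in>?P. (1 - \<alpha> k / n) * \<Phi> k (?z s k)) / real n ^ k"
    by (intro divide_right_mono sum_mono step) auto
  also have "\<dots> = (1 - \<alpha> k / n) * ((\<Sum>s\<in>?P. \<Phi> k (?z s k)) / real n ^ k)"
    by (simp add: sum_distrib_left)
  also have "\<dots> \<le> (1 - \<alpha> k / n) * (arcd_lambda n \<alpha> k * \<Phi> 0 (x0, x0))"
    by (intro mult_left_mono Suc.IH le1)
  also have "\<dots> = arcd_lambda n \<alpha> (Suc k) * \<Phi> 0 (x0, x0)"
    by (simp add: arcd_lambda_def)
  finally show ?case .
qed

end

section \<open>Decay of the coefficients\<close>

lemma arcd_params_pos: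
  assumes "arcd_params n \<mu> \<gamma>0 \<alpha> \<gamma>" "\<gamma>0 > 0"
  shows "\<gamma> k > 0"
proof (cases k)
  case (Suc j)
  then have "\<gamma> k = (\<alpha> j)\<^sup>2" "\<alpha> j > 0" using assms(1) unfolding arcd_params_def by simp_all
  then show ?thesis by simp
qed (use assms in \<open>simp add: arcd_params_def\<close>)

lemma arcd_lambda_nonneg:
  assumes "arcd_params n \<mu> \<gamma>0 \<alpha> \<gamma>" "n > 0"
  shows "arcd_lambda n \<alpha> k \<ge> 0"
  unfolding arcd_lambda_def using assms by (intro prod_nonneg) (auto simp: arcd_params_def)

text \<open>
  The parameter \<open>\<gamma>\<close> moves by convex combinations with \<open>\<mu>\<close> and so never falls below \<open>\<mu>\<close>. As
  \<open>\<alpha>\<^sub>k\<^sup>2 = \<gamma>\<^sub>k\<^sub>+\<^sub>1\<close>, every factor is at most \<open>1 - sqrt \<mu> / n\<close>.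
\<close>
lemma arcd_lambda_le_power:
  assumes params: "arcd_params n \<mu> \<gamma>0 \<alpha> \<gamma>" and n: "n > 0" and "\<mu> \<ge> 0" "\<gamma>0 \<ge> \<mu>"
  shows "arcd_lambda n \<alpha> k \<le> (1 - sqrt \<mu> / n) ^ k"
proof -
  have p: "0 < \<alpha> k" "\<alpha> k \<le> n" "\<gamma> (Suc k) = (1 - \<alpha> k / n) * \<gamma> k + \<alpha> k / n * \<mu>"
    "(\<alpha> k)\<^sup>2 = \<gamma> (Suc k)" for k
    using params by (simp_all add: arcd_params_def)
  have ge: "\<gamma> k \<ge> \<mu>" for k
  proof (induction k)
    case 0
    then show ?case using params assms by (simp add: arcd_params_def)
  next
    case (Suc k)
    have "(1 - \<alpha> k / n) * \<mu> \<le> (1 - \<alpha> k / n) * \<gamma> k"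
      using p(2)[of k] n Suc by (intro mult_left_mono) auto
    then show ?case unfolding p(3) by (simp add: algebra_simps)
  qed
  have "sqrt \<mu> \<le> \<alpha> k" for k
    using ge[of "Suc k"] p(1)[of k] by (intro real_le_lsqrt) (auto simp: p(4))
  then have "arcd_lambda n \<alpha> k \<le> (\<Prod>i<k. 1 - sqrt \<mu> / n)"
    unfolding arcd_lambda_def using p(2) n by (intro prod_mono) (auto simp: divide_right_mono)
  then show ?thesis by simp
qed

text \<open>
  Dropping the term with \<open>\<mu>\<close> from the recursion gives \<open>\<gamma>\<^sub>k \<ge> \<gamma>0 \<lambda>\<^sub>k\<close>, hence
  \<open>\<alpha>\<^sub>k \<ge> sqrt (\<gamma>0 \<lambda>\<^sub>k\<^sub>+\<^sub>1)\<close>. This makes \<open>1 / sqrt \<lambda>\<^sub>k\<close> grow by at least \<open>sqrt \<gamma>0 / (2 n)\<close> per step.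
  The induction below states the resulting bound as \<open>sqrt \<lambda>\<^sub>k * (n + k * c) \<le> n\<close>, since \<open>\<lambda>\<^sub>k\<close> vanishes
  once some \<open>\<alpha>\<^sub>k\<close> equals \<open>n\<close>.
\<close>
lemma arcd_lambda_le_quadratic:
  assumes params: "arcd_params n \<mu> \<gamma>0 \<alpha> \<gamma>" and n: "n > 0" and "\<mu> \<ge> 0" "\<gamma>0 > 0"
  shows "arcd_lambda n \<alpha> k \<le> (n / (n + k * (sqrt \<gamma>0 / 2)))\<^sup>2"
proof -
  have p: "0 < \<alpha> k" "\<alpha> k \<le> n" "\<gamma> (Suc k) = (1 - \<alpha> k / n) * \<gamma> k + \<alpha> k / n * \<mu>"
    "(\<alpha> k)\<^sup>2 = \<gamma> (Suc k)" for k
    using params by (simp_all add: arcd_params_def)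
  let ?l = "arcd_lambda n \<alpha>"
  have nn: "?l k \<ge> 0" for k by (rule arcd_lambda_nonneg[OF params n])
  have l_Suc: "?l (Suc k) = (1 - \<alpha> k / n) * ?l k" for k
    by (simp add: arcd_lambda_def)
  have ge: "\<gamma>0 * ?l k \<le> \<gamma> k" for k
  proof (induction k)
    case 0
    then show ?case using params by (simp add: arcd_params_def arcd_lambda_def)
  next
    case (Suc k)
    have "(1 - \<alpha> k / n) * (\<gamma>0 * ?l k) \<le> (1 - \<alpha> k / n) * \<gamma> k"
      using p(2)[of k] n Suc by (intro mult_left_mono) auto
    moreover have "\<alpha> k / n * \<mu> \<ge> 0" using p(1)[of k] assms by simp
    ultimately show ?case unfolding p(3) l_Suc by (simp add: algebra_simps)
  qed
  define c where "c = sqrt \<gamma>0 / 2"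
  have c: "c > 0" using assms by (simp add: c_def)
  have "sqrt (?l k) * (n + k * c) \<le> n" for k
  proof (induction k)
    case 0
    show ?case by (simp add: arcd_lambda_def)
  next
    case (Suc k)
    define a where "a = sqrt (?l k)"
    define b where "b = sqrt (?l (Suc k))"
    have a2: "a\<^sup>2 = ?l k" and b2: "b\<^sup>2 = ?l (Suc k)" and b0: "b \<ge> 0" and a0: "a \<ge> 0"
      using nn by (simp_all add: a_def b_def)
    have IH: "a * (n + k * c) \<le> n" using Suc by (simp add: a_def)
    show ?case
    proof (cases "a = 0")
      case True
      then have "b = 0" using a2 b2 l_Suc[of k] by simp
      then show ?thesis by (simp add: b_def)
    next
      case False
      then have a: "a > 0" using a0 by simp
      have b_eq: "b\<^sup>2 = a\<^sup>2 - \<alpha> k / n * a\<^sup>2"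
        unfolding a2 b2 l_Suc by (simp add: algebra_simps)
      have "b\<^sup>2 \<le> a\<^sup>2" unfolding b_eq using p(1)[of k] by simp
      then have "b \<le> a" using a by (simp add: power2_le_iff_abs_le)
      have "2 * c * b \<le> \<alpha> k"
      proof -
        have "2 * c * b = sqrt (\<gamma>0 * ?l (Suc k))"
          by (simp add: c_def b_def real_sqrt_mult)
        also have "\<dots> \<le> \<alpha> k"
          using ge[of "Suc k"] p(1)[of k] by (intro real_le_lsqrt) (auto simp: p(4))
        finally show ?thesis .
      qed
      then have "2 * c * b * a\<^sup>2 \<le> \<alpha> k * a\<^sup>2" by (intro mult_right_mono) auto
      also have "\<dots> = n * ((a - b) * (a + b))"
        using b_eq n by (simp add: field_simps power2_eq_square)
      also have "\<dots> \<le> n * ((a - b) * (2 * a))"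
        using \<open>b \<le> a\<close> by (intro mult_left_mono) auto
      finally have "(2 * a) * (c * b * a) \<le> (2 * a) * (n * (a - b))"
        by (simp add: power2_eq_square algebra_simps)
      then have 1: "c * b * a \<le> n * (a - b)"
        using a by (subst (asm) mult_le_cancel_left_pos) auto
      have "b * (a * (n + k * c)) \<le> b * n" using IH b0 by (rule mult_left_mono)
      with 1 have "a * (b * (n + Suc k * c)) \<le> a * n"
        by (simp add: algebra_simps)
      then show ?thesis using a by (subst (asm) mult_le_cancel_left_pos) (auto simp: b_def)
    qed
  qed
  moreover have "n + k * c > 0" using n c by (simp add: add_pos_nonneg)
  ultimately have "sqrt (?l k) \<le> n / (n + k * c)" by (simp add: pos_le_divide_eq)
  then have "(sqrt (?l k))\<^sup>2 \<le> (n / (n + k * c))\<^sup>2" using nn by (intro power_mono) auto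
  then show ?thesis using nn by (simp add: c_def)
qed

section \<open>The convergence rate\<close>

theorem theorem4:
  fixes f :: "real ^ 'N \<Rightarrow> real"
    and n :: nat
    and Ns :: "nat \<Rightarrow> nat"
    and U :: "nat \<Rightarrow> nat \<Rightarrow> real ^ 'N"
    and L :: "nat \<Rightarrow> real"
    and \<mu> \<gamma>0 fstar R0 :: real
    and x0 :: "real ^ 'N"
    and \<alpha> \<gamma> :: "nat \<Rightarrow> real"
    and M :: "'w measure"
    and I :: "nat \<Rightarrow> 'w \<Rightarrow> nat"
  assumes blocks: "block_permutation n Ns U"
    and f_convex: "convex_on UNIV f"
    and f_diff: "\<And>x. f differentiable (at x)"
    and f_bdd: "bdd_below (range f)"
    and opt_nonempty: "optimal_set f \<noteq> {}"
    and L_pos: "\<And>i. i \<in> {1..n} \<Longrightarrow> L i > 0"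
    and lipschitz: "block_lipschitz_gradient n Ns U L f"
    and fstar: "fstar = optimal_value f"
    and R0: "R0 = initial_distance n Ns U L f x0"
    and mu: "\<mu> = convexity_parameter n Ns U L f"
    and gamma0_pos: "\<gamma>0 > 0"
    and params: "arcd_params n \<mu> \<gamma>0 \<alpha> \<gamma>"
    and prob: "prob_space M"
    and iid: "iid_uniform_blocks n M I"
  shows "\<forall>k. prob_space.expectation M
                (\<lambda>\<omega>. f (arcd_x n Ns U L f \<mu> \<alpha> \<gamma> x0 (\<lambda>j. I j \<omega>) k)) - fstar
              \<le> arcd_lambda n \<alpha> k * (f x0 - fstar + \<gamma>0 * R0\<^sup>2 / 2)
           \<and> (\<gamma>0 \<ge> \<mu> \<longrightarrow>
                arcd_lambda n \<alpha> k
                \<le> min ((1 - sqrt \<mu> / real n) ^ k)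
                      ((real n / (real n + real k * (sqrt \<gamma>0 / 2)))\<^sup>2))"
proof (intro allI conjI impI)
  interpret weighted_blocks n Ns U L by standard (fact blocks, fact L_pos)
  note mu_props = convexity_parameter_properties[OF f_convex f_diff lipschitz, folded mu]
  fix k :: nat
  obtain xs where xs: "xs \<in> optimal_set f" and R0_eq: "R0 = norm_L n Ns U L (x0 - xs)"
    using initial_distance_attained[OF f_diff opt_nonempty] unfolding R0 by metis
  have fstar_eq: "fstar = f xs" unfolding fstar by (rule optimal_value_eq[OF xs])
  have pos: "\<gamma> k > 0" for k by (rule arcd_params_pos[OF params gamma0_pos])
  let ?P = "PiE {..<k} (\<lambda>_. {1..n})"
  let ?z = "\<lambda>s. arcd n Ns U L f \<mu> \<alpha> \<gamma> x0 s k"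
  have "prob_space.expectation M (\<lambda>\<omega>. f (arcd_x n Ns U L f \<mu> \<alpha> \<gamma> x0 (\<lambda>j. I j \<omega>) k)) - fstar
      = (\<Sum>s\<in>?P. f (fst (?z s))) / real n ^ k - fstar"
    unfolding arcd_x_def
    by (subst expectation_iid_uniform_blocks[OF prob iid n_pos, of k "\<lambda>s. f (fst (?z s))"])
       (auto cong: arcd_cong)
  also have "\<dots> = (\<Sum>s\<in>?P. f (fst (?z s)) - f xs) / real n ^ k"
    using n_pos by (simp add: fstar_eq sum_subtractf card_PiE diff_divide_distrib)
  also have "\<dots> \<le> (\<Sum>s\<in>?P. case ?z s of (x, v) \<Rightarrow>
      f x - f xs + \<gamma> k / 2 * (norm_L n Ns U L (v - xs))\<^sup>2) / real n ^ k"
    using less_imp_le[OF pos]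
    by (intro divide_right_mono sum_mono) (auto simp: case_prod_unfold)
  also have "\<dots> \<le> arcd_lambda n \<alpha> k * (f x0 - fstar + \<gamma>0 * R0\<^sup>2 / 2)"
    using mean_potential_le[OF f_convex f_diff lipschitz mu_props params pos,
        where k = k and ?x0.0 = x0 and xs = xs] params
    by (simp add: fstar_eq R0_eq arcd_params_def)
  finally show "prob_space.expectation M (\<lambda>\<omega>. f (arcd_x n Ns U L f \<mu> \<alpha> \<gamma> x0 (\<lambda>j. I j \<omega>) k)) - fstar
      \<le> arcd_lambda n \<alpha> k * (f x0 - fstar + \<gamma>0 * R0\<^sup>2 / 2)" .
  assume "\<mu> \<le> \<gamma>0"
  then show "arcd_lambda n \<alpha> k \<le> min ((1 - sqrt \<mu> / real n) ^ k)
      ((real n / (real n + real k * (sqrt \<gamma>0 / 2)))\<^sup>2)"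
    using arcd_lambda_le_power[OF params n_pos mu_props(1)]
      arcd_lambda_le_quadratic[OF params n_pos mu_props(1) gamma0_pos] by simp
qed

end
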